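(* Let $n\ge 2$. There exists a constant $C(n)>0$, depending only on the dimension $n$, such that for every $0<\delta<1$, every weight $w\in A_1$ on $\mathbb{R}^n$, every cube $Q$ in $\mathbb{R}^n$ and every $u\in C^1(Q)$, \[ \ell(Q)^{\delta}\,\left\|\frac{u(x)-u(y)}{|x-y|^{n+\delta}}\right\|_{L^{1,\infty}(Q\times Q,\;w(x)\,dx\times dy)}\le C(n)\,\frac{[w]_{A_1}^{2+\frac{1-\delta}{n}}}{\delta(1-\delta)}\,\ell(Q)\int_Q|\nabla u(x)|\,w(x)\,dx. \]
   Context: A cube $Q$ in $\mathbb{R}^n$ is a cartesian product of $n$ intervals of the same side length, denoted $\ell(Q)$. A weight is a function $w\in L^1_{\mathrm{loc}}(\mathbb{R}^n)$ with $w(x)>0$ for almost every $x$. A weight $w$ belongs to $A_1$ if there is a constant $C>0$ such that $\frac{1}{|Q|}\int_Q w(x)\,dx\le C\,\mathrm{ess\,inf}_{x\in Q}w(x)$ for every cube $Q$ in $\mathbb{R}^n$; the $A_1$ constant $[w]_{A_1}$ is the smallest such $C$. For a measurable function $F$ on $Q\times Q$, the (unnormalized) weak-$L^1$ (Marcinkiewicz) quasinorm is \[ \|F(x,y)\|_{L^{1,\infty}(Q\times Q,\;w(x)\,dx\times dy)}=\sup_{t>0}\,t\int_Q\int_Q \chi_{\{(x,y)\,:\,|F(x,y)|>t\}}(x,y)\,w(x)\,dx\,dy . \] *)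

theory Defs
  imports "HOL-Analysis.Analysis" "HOL-Probability.Essential_Supremum"
begin

text \<open>The factors of a cube are nondegenerate bounded intervals which may independently be open,
  closed or half-open; this is what the two inclusions say.\<close>

definition cube_of_side :: "real \<Rightarrow> (real^'n::finite) set \<Rightarrow> bool" where
  "cube_of_side l Q \<longleftrightarrow> l > 0 \<and>
     (\<exists>(a :: real^'n) (I :: 'n \<Rightarrow> real set).
        (\<forall>i. {a $ i <..< a $ i + l} \<subseteq> I i \<and> I i \<subseteq> {a $ i .. a $ i + l}) \<and>
        Q = {x. \<forall>i. x $ i \<in> I i})"

text \<open>All integrals and null sets refer to (completed) Lebesgue measure.\<close>

definition weight :: "(real^'n::finite \<Rightarrow> real) \<Rightarrow> bool" where
  "weight w \<longleftrightarrow>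
     (\<forall>K. compact K \<longrightarrow> w absolutely_integrable_on K) \<and> (AE x in lebesgue. w x > 0)"

definition essinf :: "'a measure \<Rightarrow> ('a \<Rightarrow> ereal) \<Rightarrow> ereal" where
  "essinf M f = - esssup M (\<lambda>x. - f x)"

definition A1_bound :: "(real^'n::finite \<Rightarrow> real) \<Rightarrow> real \<Rightarrow> bool" where
  "A1_bound w C \<longleftrightarrow> C > 0 \<and>
     (\<forall>l Q. cube_of_side l Q \<longrightarrow>
        ereal (1 / measure lebesgue Q * (LINT x:Q|lebesgue. w x))
          \<le> ereal C * essinf (restrict_space lebesgue Q) (\<lambda>x. ereal (w x)))"

definition A1_weight :: "(real^'n::finite \<Rightarrow> real) \<Rightarrow> bool" where
  "A1_weight w \<longleftrightarrow> weight w \<and> (\<exists>C. A1_bound w C)"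

text \<open>For an \<open>A\<^sub>1\<close> weight the infimum is attained, since the defining inequalities are non-strict.\<close>

definition A1_const :: "(real^'n::finite \<Rightarrow> real) \<Rightarrow> real" where
  "A1_const w = Inf {C. A1_bound w C}"

text \<open>Derivatives are taken within \<open>Q\<close>, hence one-sided at those boundary points that belong
  to \<open>Q\<close>. They are uniquely determined when \<open>Q\<close> is a cube, as it is convex with nonempty
  interior.\<close>

definition grad_within :: "(real^'n::finite) set \<Rightarrow> (real^'n \<Rightarrow> real) \<Rightarrow> real^'n \<Rightarrow> real^'n" where
  "grad_within Q u x = (\<chi> i. frechet_derivative u (at x within Q) (axis i 1))"

definition C1_on :: "(real^'n::finite) set \<Rightarrow> (real^'n \<Rightarrow> real) \<Rightarrow> bool" where
  "C1_on Q u \<longleftrightarrow> u differentiable_on Q \<and> continuous_on Q (grad_within Q u)"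

definition weak_L1_norm ::
    "(real^'n::finite) set \<Rightarrow> (real^'n \<Rightarrow> real) \<Rightarrow> (real^'n \<Rightarrow> real^'n \<Rightarrow> real) \<Rightarrow> ennreal" where
  "weak_L1_norm Q w F =
     (SUP t\<in>{0<..}. ennreal t *
        (\<integral>\<^sup>+ y\<in>Q. (\<integral>\<^sup>+ x\<in>Q.
            indicator {(x, y). \<bar>F x y\<bar> > t} (x, y) * ennreal (w x) \<partial>lebesgue) \<partial>lebesgue))"

end

theory Submission imports Defs begin

text \<open>By Chebyshev's inequality the weak norm is at most the \<open>L\<^sup>1\<close> norm of the difference quotient. Writing
  \<open>u(y) - u(x)\<close> as an integral of \<open>\<nabla>u\<close> over the segment and substituting \<open>y = x + h\<close>, \<open>z = x + sh\<close>, Tonelli's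
  theorem reduces the claim to bounding the convolution of \<open>h \<mapsto> w(z - sh)\<close> with the kernel
  \<open>|h|\<^sup>1\<^sup>-\<^sup>n\<^sup>-\<^sup>\<delta>\<close> on \<open>|h| \<le> n l\<close>. Summing over dyadic annuli, the \<open>A\<^sub>1\<close> condition bounds it by
  a multiple of \<open>[w] l\<^sup>1\<^sup>-\<^sup>\<delta> w(z) / (1 - \<delta>)\<close> for almost every \<open>z\<close>. Since \<open>[w] \<ge> 1\<close> and \<open>\<delta> < 1\<close>, this is
  stronger than required.\<close>

section \<open>Changes of variables and an elementary estimate\<close>

lemma nn_integral_lborel_translate:
  fixes f :: "'a::euclidean_space \<Rightarrow> ennreal"
  assumes [measurable]: "f \<in> borel_measurable borel"
  shows "(\<integral>\<^sup>+x. f (a + x) \<partial>lborel) = (\<integral>\<^sup>+x. f x \<partial>lborel)"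
proof -
  have "(\<integral>\<^sup>+x. f x \<partial>lborel) = (\<integral>\<^sup>+x. f x \<partial>distr lborel borel ((+) a))"
    by (simp add: lborel_distr_plus)
  also have "\<dots> = (\<integral>\<^sup>+x. f (a + x) \<partial>lborel)"
    by (subst nn_integral_distr) auto
  finally show ?thesis by simp
qed

text \<open>Affine substitution with linear part \<open>- s\<close>, whose Jacobian is
  \<open>s ^ DIM('a)\<close>. The reflection matches the argument \<open>z - s *\<^sub>R h\<close>
  at which the weight is later evaluated.\<close>

lemma nn_integral_lborel_reflect_scale:
  fixes f :: "'a::euclidean_space \<Rightarrow> ennreal"
  assumes [measurable]: "f \<in> borel_measurable borel" and "s > 0"
  shows "(\<integral>\<^sup>+x. f x \<partial>lborel) = ennreal (s ^ DIM('a)) * (\<integral>\<^sup>+x. f (z - s *\<^sub>R x) \<partial>lborel)"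
proof -
  have "(\<integral>\<^sup>+x. f x \<partial>lborel) =
      (\<integral>\<^sup>+x. f x \<partial>density (distr lborel borel (\<lambda>x. z + (- s) *\<^sub>R x)) (\<lambda>_. \<bar>- s\<bar> ^ DIM('a)))"
    using lborel_affine[of "- s" z] assms(2) by simp
  also have "\<dots> = (\<integral>\<^sup>+x. ennreal (s ^ DIM('a)) * f x \<partial>distr lborel borel (\<lambda>x. z + (- s) *\<^sub>R x))"
    using assms(2) by (subst nn_integral_density) auto
  also have "\<dots> = (\<integral>\<^sup>+x. ennreal (s ^ DIM('a)) * f (z - s *\<^sub>R x) \<partial>lborel)"
    by (subst nn_integral_distr) auto
  finally show ?thesis
    by (simp add: nn_integral_cmult)
qed

text \<open>Makes the geometric series with ratio \<open>(1 / 2) powr e\<close> sum to at most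
  \<open>4 / e\<close>; with \<open>e = 1 - d\<close> this is the source of the factor
  \<open>1 / (1 - d)\<close>. The proof uses \<open>ln 2 \<ge> 1 / 2\<close> and
  \<open>1 + x \<le> exp x\<close>.\<close>

lemma one_minus_half_powr_ge:
  fixes e :: real
  assumes "0 < e" "e < 1"
  shows "1 - (1 / 2) powr e \<ge> e / 4"
proof -
  have "(1 / 2) powr e = exp (- (e * ln 2))"
    by (simp add: powr_def ln_div)
  also have "\<dots> \<le> exp (- (e / 2))"
    using ln2_ge_two_thirds assms by (simp add: mult_left_mono)
  also have "\<dots> = 1 / exp (e / 2)"
    by (simp add: exp_minus field_simps)
  also have "\<dots> \<le> 1 / (1 + e / 2)"
    using assms exp_ge_add_one_self[of "e / 2"] by (intro divide_left_mono) auto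
  also have "\<dots> \<le> 1 - e / 4"
  proof -
    have "e * e \<le> e * 1" using assms by (intro mult_left_mono) auto
    then have "1 \<le> (1 - e / 4) * (1 + e / 2)" using assms by (simp add: algebra_simps)
    then show ?thesis using assms by (subst pos_divide_le_eq) auto
  qed
  finally show ?thesis by simp
qed

section \<open>Dyadic estimate of the Riesz kernel\<close>

text \<open>A single term suffices: for the smallest dyadic ball \<open>cball 0 (R / 2 ^ j)\<close>
  that contains \<open>h\<close>, \<open>norm h\<close> exceeds half the radius, and the power is
  antitone because \<open>p \<le> 0\<close>.\<close>

lemma riesz_kernel_le_dyadic_sum:
  fixes h :: "'a::real_normed_vector"
  assumes "R > 0" "p \<le> 0"
  shows "ennreal (norm h powr p) * indicator (cball 0 R) h
    \<le> (\<Sum>j. ennreal ((R / 2 ^ j / 2) powr p) * indicator (cball 0 (R / 2 ^ j)) h)"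
\<comment> \<open>At \<open>h = 0\<close> the left side vanishes by the convention
  \<open>0 powr p = 0\<close>, and for \<open>norm h > R\<close> by the indicator.\<close>
proof (cases "h \<noteq> 0 \<and> norm h \<le> R")
  case True
  let ?P = "\<lambda>i. R / 2 ^ i < norm h"
  obtain i0 where "R / norm h < 2 ^ i0"
    using real_arch_pow[of 2 "R / norm h"] by auto
  then have "?P i0"
    using True by (simp add: field_simps)
  define i where "i = (LEAST i. ?P i)"
  have i: "?P i" unfolding i_def by (rule LeastI[of ?P i0]) fact
  then obtain j where j: "i = Suc j" using True by (cases i) auto
  have "\<not> ?P j" using not_less_Least[of j ?P] j i_def by auto
  then have le: "norm h \<le> R / 2 ^ j" by simp
  have le_suminf: "f j \<le> suminf f" for f :: "nat \<Rightarrow> ennreal"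
    using sum_le_suminf[of f "{j}"] by simp
  have gt: "R / 2 ^ j / 2 < norm h" using i j by simp
  have "norm h powr p \<le> (R / 2 ^ j / 2) powr p"
    using gt assms by (intro powr_mono2') auto
  then have "ennreal (norm h powr p) * indicator (cball 0 R) h
      \<le> ennreal ((R / 2 ^ j / 2) powr p) * indicator (cball 0 (R / 2 ^ j)) h"
    using le True by (simp add: ennreal_leI)
  also have "\<dots> \<le> (\<Sum>j. ennreal ((R / 2 ^ j / 2) powr p) * indicator (cball 0 (R / 2 ^ j)) h)"
    by (rule le_suminf)
  finally show ?thesis .
qed auto

text \<open>Each dyadic ball contributes an average of \<open>W\<close> around \<open>z\<close> at
  scale \<open>s * r j\<close>. Rescaling cancels the powers of \<open>s\<close>, so the bound is
  uniform in \<open>s\<close>. The remaining terms are multiples of \<open>r j powr (1 - d)\<close>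
  and form a convergent geometric series.\<close>

lemma riesz_kernel_bound:
  fixes W :: "'a::euclidean_space \<Rightarrow> ennreal"
  assumes [measurable]: "W \<in> borel_measurable borel"
    and avg: "\<And>r. r > 0 \<Longrightarrow> AE z in lborel.
      (\<integral>\<^sup>+k. W k * indicator (cball z r) k \<partial>lborel) \<le> ennreal (K * r ^ DIM('a)) * W z"
    and "K > 0" "R > 0" "s > 0" "0 < d" "d < 1"
  shows "AE z in lborel.
    (\<integral>\<^sup>+h. ennreal (norm h powr (1 - real DIM('a) - d)) * indicator (cball 0 R) h * W (z - s *\<^sub>R h) \<partial>lborel)
      \<le> ennreal (4 * 2 ^ DIM('a) * K * R powr (1 - d) / (1 - d)) * W z"
proof -
  let ?n = "DIM('a)"
  define r where "r = (\<lambda>j::nat. R / 2 ^ j)"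
  define p where "p = 1 - real ?n - d"
  define q where "q = (1 / 2 :: real) powr (1 - d)"
  have r: "r j > 0" for j using assms by (simp add: r_def)
  have n1: "real ?n \<ge> 1" using DIM_positive[where 'a='a] by linarith
  have p: "p \<le> 0" using n1 \<open>0 < d\<close> unfolding p_def by linarith
  have q: "0 < q" "1 - q \<ge> (1 - d) / 4"
    using one_minus_half_powr_ge[of "1 - d"] assms by (auto simp: q_def)
  then have q1: "q < 1" using assms by auto
  \<comment> \<open>Only the countably many radii \<open>s * r j\<close> occur, so one null set
    serves them all and \<open>z\<close> can be fixed from here on.\<close>
  have "AE z in lborel. \<forall>j.
      (\<integral>\<^sup>+k. W k * indicator (cball z (s * r j)) k \<partial>lborel) \<le> ennreal (K * (s * r j) ^ ?n) * W z"
    using avg r assms by (subst AE_all_countable) auto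
  then show ?thesis
  proof eventually_elim
    case (elim z)
    have scaled: "(\<integral>\<^sup>+h. indicator (cball 0 (r j)) h * W (z - s *\<^sub>R h) \<partial>lborel)
        \<le> ennreal (K * r j ^ ?n) * W z" (is "?I j \<le> _") for j
    proof -
      have "indicator (cball z (s * r j)) (z - s *\<^sub>R h) = (indicator (cball 0 (r j)) h :: ennreal)" for h
        using assms by (auto simp: indicator_def dist_norm)
      moreover have meas: "(\<lambda>k. W k * indicator (cball z (s * r j)) k) \<in> borel_measurable borel"
        by (intro borel_measurable_times_ennreal borel_measurable_indicator) auto
      ultimately have "ennreal (s ^ ?n) * ?I j = (\<integral>\<^sup>+k. W k * indicator (cball z (s * r j)) k \<partial>lborel)"
        using nn_integral_lborel_reflect_scale[of "\<lambda>k. W k * indicator (cball z (s * r j)) k" s z, OF _ \<open>s > 0\<close>] meas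
        by (simp add: mult.commute[of "W _"])
      also have "\<dots> \<le> ennreal (K * (s * r j) ^ ?n) * W z" using elim by blast
      finally have "ennreal (1 / s ^ ?n) * (ennreal (s ^ ?n) * ?I j)
          \<le> ennreal (1 / s ^ ?n) * (ennreal (K * (s * r j) ^ ?n) * W z)"
        by (rule mult_left_mono) simp
      also have "ennreal (1 / s ^ ?n) * (ennreal (s ^ ?n) * ?I j) = ?I j"
        using assms by (subst mult.assoc[symmetric], subst ennreal_mult[symmetric]) auto
      also have "ennreal (1 / s ^ ?n) * (ennreal (K * (s * r j) ^ ?n) * W z) = ennreal (K * r j ^ ?n) * W z"
        using assms r[of j]
        by (subst mult.assoc[symmetric], subst ennreal_mult[symmetric])
           (auto simp: power_mult_distrib intro!: mult_nonneg_nonneg less_imp_le)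
      finally show ?thesis .
    qed
    \<comment> \<open>The exponents combine to \<open>p + n = 1 - d\<close>, where \<open>n\<close>
      is the dimension, which is positive; hence the decay in \<open>j\<close>.\<close>
    have coef: "(r j / 2) powr p * (K * r j ^ ?n) = K * 2 powr (- p) * R powr (1 - d) * q ^ j" for j
    proof -
      have "r j powr p * r j ^ ?n = r j powr (1 - d)"
        using r[of j] by (simp add: powr_realpow[symmetric] powr_add[symmetric] p_def)
      moreover have "r j powr (1 - d) = R powr (1 - d) * q ^ j"
        using assms by (simp add: r_def q_def powr_divide powr_power powr_powr powr_realpow[symmetric] powr_minus field_simps)
      moreover have "(r j / 2) powr p = r j powr p * 2 powr (- p)"
        using r[of j] by (simp add: powr_divide powr_minus field_simps)
      ultimately show ?thesis by (simp add: algebra_simps)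
    qed
    have meas: "(\<lambda>h. indicator (cball 0 (r j)) h * W (z - s *\<^sub>R h)) \<in> borel_measurable lborel" for j
      by (intro borel_measurable_times_ennreal borel_measurable_indicator) auto
    have "(\<integral>\<^sup>+h. ennreal (norm h powr p) * indicator (cball 0 R) h * W (z - s *\<^sub>R h) \<partial>lborel)
      \<le> (\<integral>\<^sup>+h. (\<Sum>j. ennreal ((r j / 2) powr p) * (indicator (cball 0 (r j)) h * W (z - s *\<^sub>R h))) \<partial>lborel)"
      using riesz_kernel_le_dyadic_sum[OF \<open>R > 0\<close> p]
      by (intro nn_integral_mono) (auto simp: r_def mult.assoc[symmetric] ennreal_suminf_multc intro!: mult_right_mono)
    also have "\<dots> = (\<Sum>j. ennreal ((r j / 2) powr p) * ?I j)"
      using meas by (simp add: nn_integral_suminf nn_integral_cmult)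
    also have "\<dots> \<le> (\<Sum>j. ennreal ((r j / 2) powr p) * (ennreal (K * r j ^ ?n) * W z))"
      by (intro suminf_le mult_left_mono scaled) auto
    also have "\<dots> = (\<Sum>j. ennreal (K * 2 powr (- p) * R powr (1 - d) * q ^ j)) * W z"
    proof -
      have "ennreal ((r j / 2) powr p) * (ennreal (K * r j ^ ?n) * W z)
          = ennreal (K * 2 powr (- p) * R powr (1 - d) * q ^ j) * W z" for j
        using \<open>K > 0\<close> r[of j] unfolding coef[symmetric]
        by (subst ennreal_mult) (auto simp: mult.assoc)
      then show ?thesis by (simp add: ennreal_suminf_multc)
    qed
    also have "(\<Sum>j. ennreal (K * 2 powr (- p) * R powr (1 - d) * q ^ j))
        = ennreal (K * 2 powr (- p) * R powr (1 - d) * (1 / (1 - q)))"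
      using q q1 assms by (intro suminf_ennreal_eq sums_mult geometric_sums) auto
    also have "ennreal (K * 2 powr (- p) * R powr (1 - d) * (1 / (1 - q)))
        \<le> ennreal (K * 2 ^ ?n * R powr (1 - d) * (4 / (1 - d)))"
    proof (intro ennreal_leI mult_mono)
      \<comment> \<open>Here \<open>- p = n - 1 + d < n\<close>, because
        \<open>d < 1\<close>.\<close>
      have "2 powr (- p) \<le> 2 powr real ?n" using assms by (intro powr_mono) (auto simp: p_def)
      then show "2 powr (- p) \<le> 2 ^ ?n" by (simp add: powr_realpow)
      have "1 / (1 - q) \<le> 1 / ((1 - d) / 4)" using q q1 assms by (intro divide_left_mono) auto
      then show "1 / (1 - q) \<le> 4 / (1 - d)" by simp
    qed (use q1 assms in auto)
    also have "K * 2 ^ ?n * R powr (1 - d) * (4 / (1 - d)) = 4 * 2 ^ ?n * K * R powr (1 - d) / (1 - d)"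
      by simp
    finally show ?case
      by (simp add: p_def mult_right_mono)
  qed
qed

section \<open>Tonelli's theorem along segments\<close>

text \<open>After \<open>y = x + h\<close>, the point \<open>z = x + s *\<^sub>R h\<close> replaces
  \<open>x\<close> for fixed \<open>s\<close> and \<open>h\<close>. This frees \<open>g\<close> from
  \<open>h\<close> and moves the shift to \<open>W\<close>, so the integral over \<open>h\<close>
  can be done first, where \<open>bd\<close> applies. The bound does not depend on \<open>s\<close>,
  and \<open>s\<close> ranges over an interval of length 1.\<close>

lemma kernel_segment_integral_bound:
  fixes W g k :: "'a::euclidean_space \<Rightarrow> ennreal"
  assumes [measurable]: "W \<in> borel_measurable borel" "g \<in> borel_measurable borel" "k \<in> borel_measurable borel"
    and bd: "\<And>s. s > 0 \<Longrightarrow> AE z in lborel. (\<integral>\<^sup>+h. k h * W (z - s *\<^sub>R h) \<partial>lborel) \<le> B * W z"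
  shows "(\<integral>\<^sup>+y. \<integral>\<^sup>+x. k (y - x) * W x * (\<integral>\<^sup>+s. g (x + s *\<^sub>R (y - x)) * indicator {0..1} s \<partial>lborel) \<partial>lborel \<partial>lborel)
    \<le> B * (\<integral>\<^sup>+z. g z * W z \<partial>lborel)"
proof -
  have "(\<integral>\<^sup>+y. \<integral>\<^sup>+x. k (y - x) * W x * (\<integral>\<^sup>+s. g (x + s *\<^sub>R (y - x)) * indicator {0..1} s \<partial>lborel) \<partial>lborel \<partial>lborel)
     = (\<integral>\<^sup>+x. \<integral>\<^sup>+y. k (y - x) * W x * (\<integral>\<^sup>+s. g (x + s *\<^sub>R (y - x)) * indicator {0..1::real} s \<partial>lborel) \<partial>lborel \<partial>lborel)"
    by (rule lborel_pair.Fubini') measurable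
  also have "\<dots> = (\<integral>\<^sup>+x. \<integral>\<^sup>+h. k h * W x * (\<integral>\<^sup>+s. g (x + s *\<^sub>R h) * indicator {0..1::real} s \<partial>lborel) \<partial>lborel \<partial>lborel)"
  proof (rule nn_integral_cong)
    fix x
    show "(\<integral>\<^sup>+y. k (y - x) * W x * (\<integral>\<^sup>+s. g (x + s *\<^sub>R (y - x)) * indicator {0..1::real} s \<partial>lborel) \<partial>lborel)
       = (\<integral>\<^sup>+h. k h * W x * (\<integral>\<^sup>+s. g (x + s *\<^sub>R h) * indicator {0..1::real} s \<partial>lborel) \<partial>lborel)"
      using nn_integral_lborel_translate[of "\<lambda>y. k (y - x) * W x * (\<integral>\<^sup>+s. g (x + s *\<^sub>R (y - x)) * indicator {0..1::real} s \<partial>lborel)" x]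
      by simp
  qed
  also have "\<dots> = (\<integral>\<^sup>+x. \<integral>\<^sup>+h. \<integral>\<^sup>+s. k h * W x * (g (x + s *\<^sub>R h) * indicator {0..1::real} s) \<partial>lborel \<partial>lborel \<partial>lborel)"
    by (intro nn_integral_cong nn_integral_cmult[symmetric]) measurable
  also have "\<dots> = (\<integral>\<^sup>+x. \<integral>\<^sup>+s. \<integral>\<^sup>+h. k h * W x * (g (x + s *\<^sub>R h) * indicator {0..1::real} s) \<partial>lborel \<partial>lborel \<partial>lborel)"
    by (intro nn_integral_cong lborel_pair.Fubini') measurable
  also have "\<dots> = (\<integral>\<^sup>+s. \<integral>\<^sup>+x. \<integral>\<^sup>+h. k h * W x * (g (x + s *\<^sub>R h) * indicator {0..1::real} s) \<partial>lborel \<partial>lborel \<partial>lborel)"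
    by (rule lborel_pair.Fubini') measurable
  also have "\<dots> = (\<integral>\<^sup>+s. \<integral>\<^sup>+h. \<integral>\<^sup>+x. k h * W x * (g (x + s *\<^sub>R h) * indicator {0..1::real} s) \<partial>lborel \<partial>lborel \<partial>lborel)"
    by (intro nn_integral_cong lborel_pair.Fubini') measurable
  also have "\<dots> = (\<integral>\<^sup>+s. \<integral>\<^sup>+h. \<integral>\<^sup>+z. k h * W (z - s *\<^sub>R h) * (g z * indicator {0..1::real} s) \<partial>lborel \<partial>lborel \<partial>lborel)"
  proof (rule nn_integral_cong, rule nn_integral_cong)
    fix s :: real and h :: 'a
    show "(\<integral>\<^sup>+x. k h * W x * (g (x + s *\<^sub>R h) * indicator {0..1} s) \<partial>lborel)
       = (\<integral>\<^sup>+z. k h * W (z - s *\<^sub>R h) * (g z * indicator {0..1} s) \<partial>lborel)"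
      by (subst nn_integral_lborel_translate[of _ "- (s *\<^sub>R h)", symmetric]) auto
  qed
  also have "\<dots> = (\<integral>\<^sup>+s. \<integral>\<^sup>+z. \<integral>\<^sup>+h. k h * W (z - s *\<^sub>R h) * (g z * indicator {0..1::real} s) \<partial>lborel \<partial>lborel \<partial>lborel)"
    by (intro nn_integral_cong lborel_pair.Fubini') measurable
  also have "\<dots> = (\<integral>\<^sup>+s. \<integral>\<^sup>+z. (\<integral>\<^sup>+h. k h * W (z - s *\<^sub>R h) \<partial>lborel) * (g z * indicator {0..1::real} s) \<partial>lborel \<partial>lborel)"
    by (intro nn_integral_cong nn_integral_multc) measurable
  also have "\<dots> \<le> (\<integral>\<^sup>+s. indicator {0..1::real} s * (B * (\<integral>\<^sup>+z. g z * W z \<partial>lborel)) \<partial>lborel)"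
  \<comment> \<open>The hypothesis \<open>bd\<close> covers only positive \<open>s\<close>; the
    point \<open>s = 0\<close> is discarded as a null set.\<close>
  proof (rule nn_integral_mono_AE, rule AE_mp[OF AE_lborel_singleton[of 0]], intro AE_I2 impI)
    fix s :: real assume "s \<noteq> 0"
    show "(\<integral>\<^sup>+z. (\<integral>\<^sup>+h. k h * W (z - s *\<^sub>R h) \<partial>lborel) * (g z * indicator {0..1} s) \<partial>lborel)
       \<le> indicator {0..1} s * (B * (\<integral>\<^sup>+z. g z * W z \<partial>lborel))"
    proof (cases "s \<in> {0..1}")
      case True
      with \<open>s \<noteq> 0\<close> have "s > 0" by auto
      have "(\<integral>\<^sup>+z. (\<integral>\<^sup>+h. k h * W (z - s *\<^sub>R h) \<partial>lborel) * g z \<partial>lborel) \<le> (\<integral>\<^sup>+z. B * (g z * W z) \<partial>lborel)"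
        using bd[OF \<open>s > 0\<close>]
        by (intro nn_integral_mono_AE) (auto elim!: eventually_mono simp: mult.assoc mult.commute[of "g _"] mult_right_mono
             simp flip: mult.assoc)
      also have "\<dots> = B * (\<integral>\<^sup>+z. g z * W z \<partial>lborel)" by (rule nn_integral_cmult) measurable
      finally show ?thesis using True by simp
    qed auto
  qed
  also have "\<dots> = B * (\<integral>\<^sup>+z. g z * W z \<partial>lborel)"
    by (subst nn_integral_multc) auto
  finally show ?thesis .
qed

section \<open>Geometry and measurability of cubes\<close>

lemma cube_of_side_factors:
  fixes Q :: "(real^'n::finite) set"
  assumes "cube_of_side l Q"
  shows "\<exists>a I. (\<forall>i. {a $ i <..< a $ i + l} \<subseteq> I i) \<and> (\<forall>i. I i \<subseteq> {a $ i .. a $ i + l}) \<and> Q = {x. \<forall>i. x $ i \<in> I i}"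
  using assms unfolding cube_of_side_def by blast

lemma cube_convex:
  fixes Q :: "(real^'n::finite) set"
  assumes "cube_of_side l Q" shows "convex Q"
proof -
  obtain a I where *: "\<forall>i. {a $ i <..< a $ i + l} \<subseteq> I i" "\<forall>i. I i \<subseteq> {a $ i .. a $ i + l}"
      and Q: "Q = {x. \<forall>i. x $ i \<in> I i}"
    using cube_of_side_factors[OF assms] by blast
  from * have aI: "{a $ i <..< a $ i + l} \<subseteq> I i" "I i \<subseteq> {a $ i .. a $ i + l}" for i
    by auto
  have "is_interval (I i)" for i
    unfolding is_interval_1
  proof safe
    fix x y z assume xyz: "x \<in> I i" "y \<in> I i" "x \<le> z" "z \<le> y"
    then have "a $ i \<le> x" "y \<le> a $ i + l" using aI(2)[of i] by auto
    \<comment> \<open>If \<open>z\<close> is neither \<open>x\<close> nor \<open>y\<close>, it lies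
      strictly between them and so in the open interval, which every factor contains whatever its
      endpoints do.\<close>
    then have "z = x \<or> z = y \<or> z \<in> {a $ i <..< a $ i + l}" using xyz by auto
    then show "z \<in> I i" using xyz aI(1)[of i] by blast
  qed
  then have "convex (I i)" for i by (rule is_interval_convex)
  moreover have "Q = (\<Inter>i. (\<lambda>x. x $ i) -` I i)" unfolding Q by auto
  moreover have "linear (\<lambda>x::real^'n. x $ i)" for i
    by (rule bounded_linear.linear) (rule bounded_linear_vec_nth)
  ultimately show ?thesis
    by (auto intro!: convex_INT convex_linear_vimage)
qed

text \<open>Each factor is an open interval together with at most its two endpoints.\<close>

lemma cube_borel:
  fixes Q :: "(real^'n::finite) set"
  assumes "cube_of_side l Q" shows "Q \<in> sets borel"
proof -
  obtain a I where *: "\<forall>i. {a $ i <..< a $ i + l} \<subseteq> I i" "\<forall>i. I i \<subseteq> {a $ i .. a $ i + l}"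
      and Q: "Q = {x. \<forall>i. x $ i \<in> I i}"
    using cube_of_side_factors[OF assms] by blast
  from * have aI: "{a $ i <..< a $ i + l} \<subseteq> I i" "I i \<subseteq> {a $ i .. a $ i + l}" for i
    by auto
  have "I i \<in> sets borel" for i
  proof -
    have "I i = {a $ i <..< a $ i + l} \<union> (I i \<inter> {a $ i, a $ i + l})"
      using aI[of i] by (fastforce simp: subset_iff)
    moreover have "I i \<inter> {a $ i, a $ i + l} \<in> sets borel"
      by (rule borel_closed, rule finite_imp_closed) auto
    ultimately show ?thesis by (metis borel_open open_greaterThanLessThan sets.Un)
  qed
  note [measurable] = this
  have [measurable]: "(\<lambda>x::real^'n. x $ i) \<in> borel_measurable borel" for i
    by (intro borel_measurable_continuous_onI continuous_intros)
  show ?thesis unfolding Q by measurable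
qed

text \<open>The Euclidean norm is at most the sum of the absolute coordinates. This crude diameter
  bound fixes the radius at which the kernel is cut off.\<close>

lemma cube_norm_diff_le:
  fixes Q :: "(real^'n::finite) set" and l :: real
  assumes "cube_of_side l Q" and "x \<in> Q" "y \<in> Q"
  shows "norm (x - y) \<le> CARD('n) * l"
proof -
  obtain a I where aI: "\<forall>i. I i \<subseteq> {a $ i .. a $ i + l}" and Q: "Q = {x. \<forall>i. x $ i \<in> I i}"
    using cube_of_side_factors[OF assms(1)] by blast
  have "x $ i \<in> {a $ i .. a $ i + l} \<and> y $ i \<in> {a $ i .. a $ i + l}" for i
    using assms aI unfolding Q by blast
  then have "\<bar>(x - y) $ i\<bar> \<le> l" for i
    by (simp add: abs_le_iff) (smt (verit))
  then have "(\<Sum>i\<in>UNIV. \<bar>(x - y) $ i\<bar>) \<le> (\<Sum>i\<in>(UNIV::'n set). l)" by (intro sum_mono) auto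
  then show ?thesis using norm_le_l1_cart[of "x - y"] by simp
qed

section \<open>Gradient and differences along segments\<close>

lemma frechet_derivative_eq_grad_within:
  fixes u :: "real^'n::finite \<Rightarrow> real"
  assumes "u differentiable (at x within Q)"
  shows "frechet_derivative u (at x within Q) h = grad_within Q u x \<bullet> h"
proof -
  let ?D = "frechet_derivative u (at x within Q)"
  have "linear ?D" using assms by (rule linear_frechet_derivative)
  then have "?D (\<Sum>i\<in>UNIV. h $ i *s axis i 1) = (\<Sum>i\<in>UNIV. h $ i * ?D (axis i 1))"
    by (simp add: linear_sum linear_cmul scalar_mult_eq_scaleR)
  then show ?thesis
    by (simp add: basis_expansion grad_within_def inner_vec_def mult.commute)
qed

text \<open>Fundamental theorem of calculus along the segment from \<open>x\<close> to
  \<open>y\<close>, then Cauchy-Schwarz. The indicator of \<open>Q\<close> changes nothing, as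
  convexity keeps the segment in \<open>Q\<close>, but it makes the integrand a function on the
  whole space, as Tonelli's theorem requires.\<close>

lemma diff_le_segment_integral:
  fixes u :: "real^'n::finite \<Rightarrow> real"
  assumes "convex Q" "C1_on Q u" "x \<in> Q" "y \<in> Q"
  shows "ennreal \<bar>u x - u y\<bar> \<le> ennreal (norm (y - x)) *
    (\<integral>\<^sup>+s. ennreal (norm (grad_within Q u (x + s *\<^sub>R (y - x)))) * indicator Q (x + s *\<^sub>R (y - x))
       * indicator {0..1} s \<partial>lborel)"
proof -
  define c where "c = (\<lambda>s. x + s *\<^sub>R (y - x))"
  let ?G = "grad_within Q u"
  have c: "c s \<in> Q" if "s \<in> {0..1}" for s
    using convexD_alt[OF assms(1,3,4), of s] that by (simp add: c_def algebra_simps)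
  have "continuous_on {0..1} c" unfolding c_def by (intro continuous_intros)
  then have cG: "continuous_on {0..1} (\<lambda>s. ?G (c s))"
    using assms(2) c unfolding C1_on_def
    by (intro continuous_on_compose2[of Q ?G "{0..1}" c]) auto
  have "((\<lambda>s. u (c s)) has_vector_derivative ?G (c s) \<bullet> (y - x)) (at s within {0..1})"
    if s: "s \<in> {0..1}" for s
  proof -
    have diff: "u differentiable (at (c s) within Q)"
      using assms(2) c[OF s] by (auto simp: C1_on_def differentiable_on_def)
    have "frechet_derivative u (at (c s) within Q) = (\<lambda>h. ?G (c s) \<bullet> h)"
      using frechet_derivative_eq_grad_within[OF diff] by auto
    then have du: "(u has_derivative (\<lambda>h. ?G (c s) \<bullet> h)) (at (c s) within Q)"
      using diff frechet_derivative_works by metis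
    have dc: "(c has_derivative (\<lambda>t. t *\<^sub>R (y - x))) (at s within {0..1})"
      unfolding c_def by (auto intro!: derivative_eq_intros)
    \<comment> \<open>Since the path stays in \<open>Q\<close>, the chain rule holds for derivatives
      within \<open>Q\<close>, also when the path meets the boundary.\<close>
    have "c ` {0..1} \<subseteq> Q" using c by auto
    then have "((\<lambda>s. u (c s)) has_derivative (\<lambda>t. ?G (c s) \<bullet> (t *\<^sub>R (y - x)))) (at s within {0..1})"
      by (rule has_derivative_in_compose[OF dc has_derivative_subset[OF du]])
    then show ?thesis unfolding has_vector_derivative_def by (simp add: mult.commute)
  qed
  then have ftc: "((\<lambda>s. ?G (c s) \<bullet> (y - x)) has_integral (u y - u x)) {0..1}"
    using fundamental_theorem_of_calculus[of 0 1 "\<lambda>s. u (c s)"] by (simp add: c_def)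
  have int: "(\<lambda>s. norm (?G (c s)) * norm (y - x)) integrable_on {0..1}"
    using cG by (intro integrable_continuous_real continuous_intros)
  have meas: "(\<lambda>s. indicator {0..1} s *\<^sub>R norm (?G (c s))) \<in> borel_measurable borel"
    using cG by (intro borel_measurable_continuous_on_indicator continuous_intros) auto
  have "\<bar>u x - u y\<bar> = norm (integral {0..1} (\<lambda>s. ?G (c s) \<bullet> (y - x)))"
    using ftc by (simp add: integral_unique abs_minus_commute)
  also have "\<dots> \<le> integral {0..1} (\<lambda>s. norm (?G (c s)) * norm (y - x))"
    using ftc int by (intro Henstock_Kurzweil_Integration.integral_norm_bound_integral)
      (auto simp: Cauchy_Schwarz_ineq2)
  finally have "ennreal \<bar>u x - u y\<bar> \<le> ennreal (integral {0..1} (\<lambda>s. norm (?G (c s)) * norm (y - x)))"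
    by (rule ennreal_leI)
  also have "\<dots> = (\<integral>\<^sup>+s. ennreal (norm (?G (c s)) * norm (y - x)) * indicator {0..1} s \<partial>lborel)"
    by (subst nn_integral_has_integral_lebesgue'[OF _ integrable_integral[OF int]]) auto
  also have "\<dots> = (\<integral>\<^sup>+s. ennreal (norm (y - x)) *
      (indicator {0..1} s *\<^sub>R norm (?G (c s))) \<partial>lborel)"
    by (intro nn_integral_cong) (auto simp: ennreal_mult mult.commute split: split_indicator)
  also have "\<dots> = ennreal (norm (y - x)) * (\<integral>\<^sup>+s. (indicator {0..1} s *\<^sub>R norm (?G (c s))) \<partial>lborel)"
    using meas by (intro nn_integral_cmult measurable_compose[OF _ measurable_ennreal]) auto
  also have "(\<integral>\<^sup>+s. (indicator {0..1} s *\<^sub>R norm (?G (c s))) \<partial>lborel) =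
     (\<integral>\<^sup>+s. ennreal (norm (?G (c s))) * indicator Q (c s) * indicator {0..1} s \<partial>lborel)"
    using c by (intro nn_integral_cong) (auto split: split_indicator)
  finally show ?thesis unfolding c_def .
qed

section \<open>The A1 condition: pointwise form, lower bound of the constant, averages over
  balls\<close>

text \<open>A function is almost everywhere at least its essential infimum, and null sets of the
  measure restricted to \<open>Q\<close> are null sets inside \<open>Q\<close>.\<close>

lemma A1_bound_AE:
  assumes "A1_bound w C" "cube_of_side l Q"
  shows "AE x in lebesgue. x \<in> Q \<longrightarrow> 1 / measure lebesgue Q * (LINT x:Q|lebesgue. w x) \<le> C * w x"
proof -
  let ?M = "restrict_space lebesgue Q"
  have Q: "Q \<in> sets lebesgue" using cube_borel[OF assms(2)] by simp
  have "AE x in ?M. 1 / measure lebesgue Q * (LINT x:Q|lebesgue. w x) \<le> C * w x"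
    using esssup_AE[of "\<lambda>x. - ereal (w x)" ?M]
  proof eventually_elim
    case (elim x)
    then have "essinf ?M (\<lambda>x. ereal (w x)) \<le> ereal (w x)"
      unfolding essinf_def by (subst ereal_uminus_le_reorder) simp
    then have "ereal C * essinf ?M (\<lambda>x. ereal (w x)) \<le> ereal C * ereal (w x)"
      using assms(1) by (intro ereal_mult_left_mono) (auto simp: A1_bound_def)
    moreover have "ereal (1 / measure lebesgue Q * (LINT x:Q|lebesgue. w x)) \<le> ereal C * essinf ?M (\<lambda>x. ereal (w x))"
      using assms unfolding A1_bound_def by blast
    ultimately show ?case by (metis dual_order.trans ereal_less_eq(3) times_ereal.simps(1))
  qed
  then show ?thesis using Q by (subst (asm) AE_restrict_space_iff) auto
qed

text \<open>The infimum is approached by admissible constants \<open>C k\<close>. Their exceptional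
  null sets are countably many, and outside the union one lets \<open>k\<close> tend to infinity at
  each point, using \<open>w x > 0\<close>.\<close>

lemma A1_const_AE:
  assumes "A1_weight w" "cube_of_side l Q"
  shows "AE x in lebesgue. x \<in> Q \<longrightarrow> 1 / measure lebesgue Q * (LINT x:Q|lebesgue. w x) \<le> A1_const w * w x"
proof -
  let ?S = "{C. A1_bound w C}"
  have ne: "?S \<noteq> {}" using assms(1) by (auto simp: A1_weight_def)
  have bb: "bdd_below ?S" by (rule bdd_belowI[of _ 0]) (auto simp: A1_bound_def)
  have "\<exists>C. A1_bound w C \<and> C < A1_const w + inverse (Suc k)" for k
    using cInf_less_iff[OF ne bb, of "A1_const w + inverse (Suc k)"] by (auto simp: A1_const_def)
  then obtain C where C: "\<And>k. A1_bound w (C k)" "\<And>k. C k < A1_const w + inverse (Suc k)"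
    by metis
  have "AE x in lebesgue. \<forall>k. x \<in> Q \<longrightarrow> 1 / measure lebesgue Q * (LINT x:Q|lebesgue. w x) \<le> C k * w x"
    using A1_bound_AE[OF C(1) assms(2)] by (subst AE_all_countable) auto
  moreover have "AE x in lebesgue. w x > 0" using assms(1) by (auto simp: A1_weight_def weight_def)
  ultimately show ?thesis
  proof eventually_elim
    case (elim x)
    have "(\<lambda>k. (A1_const w + inverse (real (Suc k))) * w x) \<longlonglongrightarrow> (A1_const w + 0) * w x"
      by (intro tendsto_intros LIMSEQ_inverse_real_of_nat)
    moreover have "1 / measure lebesgue Q * (LINT x:Q|lebesgue. w x) \<le> (A1_const w + inverse (real (Suc k))) * w x"
      if "x \<in> Q" for k
    proof -
      have "C k * w x \<le> (A1_const w + inverse (real (Suc k))) * w x"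
        using elim C(2)[of k] by (intro mult_right_mono) auto
      then show ?thesis using elim that by (meson order_trans)
    qed
    ultimately show ?case by (auto intro: LIMSEQ_le_const)
  qed
qed

lemma cbox_cube:
  fixes a :: "real^'n::finite"
  assumes "r > 0"
  shows "cube_of_side r (cbox a (a + vec r))" "measure lebesgue (cbox a (a + vec r)) = r ^ CARD('n)"
proof -
  show "cube_of_side r (cbox a (a + vec r))"
    unfolding cube_of_side_def using assms
    by (intro conjI exI[of _ a] exI[of _ "\<lambda>i. {a $ i .. a $ i + r}"]) (auto simp: mem_box_cart)
  have "measure lborel (cbox a (a + vec r)) = (\<Prod>i\<in>UNIV. (a + vec r) $ i - a $ i)"
    using assms by (subst content_cbox_cart) (auto simp: interval_ne_empty_cart)
  then show "measure lebesgue (cbox a (a + vec r)) = r ^ CARD('n)" by simp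
qed

text \<open>Integrating the pointwise inequality over a cube of measure 1 gives
  \<open>v \<le> A1_const w * v\<close> for the mean \<open>v\<close> of \<open>w\<close>, and
  \<open>v\<close> is positive. The bound later permits raising the exponent of the
  constant.\<close>

lemma A1_const_ge_1:
  fixes w :: "real^'n::finite \<Rightarrow> real"
  assumes "A1_weight w" shows "A1_const w \<ge> 1"
proof -
  let ?Q = "cbox 0 (0 + vec 1) :: (real^'n) set"
  have m: "measure lebesgue ?Q = 1" using cbox_cube(2)[of 1 "0::real^'n"] by simp
  have wi: "set_integrable lebesgue ?Q w" and wp: "AE x in lebesgue. w x > 0"
    using assms compact_cbox unfolding A1_weight_def weight_def by blast+
  define v where "v = (LINT x:?Q|lebesgue. w x)"
  have "v \<ge> 0" unfolding v_def set_lebesgue_integral_def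
    using wp by (intro integral_nonneg_AE) (auto elim!: eventually_mono)
  moreover have "v \<noteq> 0"
  proof
    \<comment> \<open>A vanishing integral would force \<open>w = 0\<close> almost everywhere on the
      cube, contradicting \<open>w > 0\<close> almost everywhere because the cube has measure
      1.\<close>
    assume "v = 0"
    then have "AE x in lebesgue. indicator ?Q x *\<^sub>R w x = 0"
      using wi wp unfolding v_def set_lebesgue_integral_def set_integrable_def
      by (subst (asm) integral_nonneg_eq_0_iff_AE) (auto elim!: eventually_mono)
    then have "AE x in lebesgue. x \<notin> ?Q"
      using wp by eventually_elim (auto split: split_indicator_asm)
    then have "?Q \<in> null_sets lebesgue"
      by (subst (asm) AE_iff_null_sets[symmetric]) auto
    then show False using m by (simp add: measure_def null_sets_def)
  qed
  moreover have "v \<le> A1_const w * v"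
  proof -
    have "(LINT x:?Q|lebesgue. v) \<le> (LINT x:?Q|lebesgue. A1_const w * w x)"
      unfolding set_lebesgue_integral_def
    proof (rule integral_mono_AE)
      show "integrable lebesgue (\<lambda>x. indicator ?Q x *\<^sub>R (A1_const w * w x))"
        using set_integrable_mult_right[OF wi, of "A1_const w"] unfolding set_integrable_def .
      show "integrable lebesgue (\<lambda>x. indicator ?Q x *\<^sub>R v)" 
        by (intro integrable_scaleR_left integrable_real_indicator) (auto simp: emeasure_lborel_cbox_eq)
      show "AE x in lebesgue. indicator ?Q x *\<^sub>R v \<le> indicator ?Q x *\<^sub>R (A1_const w * w x)"
        using A1_const_AE[OF assms cbox_cube(1)[of 1 0]] m by (auto simp: v_def elim!: eventually_mono split: split_indicator)
    qed
    moreover have "(LINT x:?Q|lebesgue. v) = v"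
      using m by (simp add: set_integral_const emeasure_lborel_cbox_eq)
    ultimately show ?thesis by (simp add: v_def)
  qed
  ultimately show ?thesis by (simp add: mult_le_cancel_right1)
qed

lemma A1_ball_average:
  fixes w :: "real^'n::finite \<Rightarrow> real"
  assumes "A1_weight w" "r > 0"
  shows "AE z in lebesgue. (\<integral>\<^sup>+k. ennreal (w k) * indicator (cball z r) k \<partial>lebesgue)
     \<le> ennreal (A1_const w * 3 ^ CARD('n) * r ^ CARD('n)) * ennreal (w z)"
proof -
  \<comment> \<open>Every ball of radius \<open>r\<close> lies in one of the countably many cubes of side \<open>3r\<close> with corners on the grid
    \<open>r\<int>\<^sup>n\<close>, so that the exceptional null sets can be united.\<close>
  define a :: "(int, 'n) vec \<Rightarrow> real^'n" where "a m = (\<chi> i. r * (of_int (m $ i) - 1))" for m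
  define Q where "Q m = cbox (a m) (a m + vec (3 * r))" for m
  have Q: "cube_of_side (3 * r) (Q m)" "measure lebesgue (Q m) = (3 * r) ^ CARD('n)" for m
    unfolding Q_def using cbox_cube[of "3 * r" "a m"] assms by auto
  have wi: "set_integrable lebesgue (Q m) w" and wp: "AE x in lebesgue. w x > 0" for m
    using assms(1) compact_cbox unfolding A1_weight_def weight_def Q_def by blast+
  have "AE z in lebesgue. \<forall>m. z \<in> Q m \<longrightarrow> 1 / (3 * r) ^ CARD('n) * (LINT x:Q m|lebesgue. w x) \<le> A1_const w * w z"
    using A1_const_AE[OF assms(1) Q(1)] unfolding Q(2) by (subst AE_all_countable) auto
  then show ?thesis using wp
  proof eventually_elim
    case (elim z)
    \<comment> \<open>The grid cell of side \<open>r\<close> with index \<open>m\<close> contains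
      \<open>z\<close>. The shift by \<open>- 1\<close> in \<open>a\<close> puts this cell in the
      middle of \<open>Q m\<close>, leaving a margin of \<open>r\<close> on every side for the
      ball.\<close>
    define m :: "(int, 'n) vec" where "m = (\<chi> i. \<lfloor>z $ i / r\<rfloor>)"
    have m: "r * of_int (m $ i) \<le> z $ i" "z $ i \<le> r * (of_int (m $ i) + 1)" for i
    proof -
      have "of_int (m $ i) \<le> z $ i / r" "z $ i / r \<le> of_int (m $ i) + 1" unfolding m_def by auto
      then show "r * of_int (m $ i) \<le> z $ i" "z $ i \<le> r * (of_int (m $ i) + 1)"
        using assms(2) by (simp_all add: field_simps)
    qed
    have sub: "cball z r \<subseteq> Q m"
    proof
      fix k assume "k \<in> cball z r"
      then have "\<bar>(k - z) $ i\<bar> \<le> r" for i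
        using component_le_norm_cart[of "k - z" i] by (simp add: dist_norm norm_minus_commute)
      then show "k \<in> Q m"
        using m unfolding Q_def mem_box_cart a_def by (simp add: algebra_simps abs_le_iff) (smt (verit))
    qed
    then have "z \<in> Q m" using assms(2) by auto
    then have "1 / (3 * r) ^ CARD('n) * (LINT x:Q m|lebesgue. w x) \<le> A1_const w * w z"
      using elim by blast
    \<comment> \<open>The volume \<open>(3 * r) ^ n\<close> of the cube, with \<open>n\<close> the
      dimension, is the source of the factor \<open>3 ^ n\<close>.\<close>
    then have le: "(LINT x:Q m|lebesgue. w x) \<le> A1_const w * 3 ^ CARD('n) * r ^ CARD('n) * w z"
      using assms(2) by (simp add: field_simps power_mult_distrib)
    have "(\<integral>\<^sup>+k. ennreal (w k) * indicator (cball z r) k \<partial>lebesgue) \<le> (\<integral>\<^sup>+k. ennreal (indicator (Q m) k *\<^sub>R w k) \<partial>lebesgue)"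
      using sub by (intro nn_integral_mono) (auto split: split_indicator)
    also have "\<dots> = ennreal (LINT x:Q m|lebesgue. w x)"
      unfolding set_lebesgue_integral_def using wi[of m] wp unfolding set_integrable_def
      by (intro nn_integral_eq_integral) (auto elim!: eventually_mono)
    also have "\<dots> \<le> ennreal (A1_const w * 3 ^ CARD('n) * r ^ CARD('n) * w z)" using le by (rule ennreal_leI)
    also have "\<dots> = ennreal (A1_const w * 3 ^ CARD('n) * r ^ CARD('n)) * ennreal (w z)"
      using A1_const_ge_1[OF assms(1)] elim assms(2) by (intro ennreal_mult) auto
    finally show ?case .
  qed
qed

text \<open>The weight is the pointwise limit of its truncations to the balls
  \<open>cball 0 k\<close>, which are measurable by local integrability.\<close>

lemma weight_borel_measurable:
  fixes w :: "real^'n::finite \<Rightarrow> real"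
  assumes "weight w" shows "w \<in> borel_measurable lebesgue"
proof (rule borel_measurable_LIMSEQ_real)
  fix x :: "real^'n"
  obtain N :: nat where "norm x \<le> real N" using real_arch_simple by blast
  then have "eventually (\<lambda>k::nat. indicator (cball 0 (real k)) x *\<^sub>R w x = w x) sequentially"
    by (intro eventually_sequentiallyI[of N]) auto
  then show "(\<lambda>k::nat. indicator (cball 0 (real k)) x *\<^sub>R w x) \<longlonglongrightarrow> w x"
    by (rule tendsto_eventually)
next
  fix k :: nat
  have "set_integrable lebesgue (cball 0 (real k)) w"
    using assms compact_cball unfolding weight_def by blast
  then show "(\<lambda>x. indicator (cball 0 (real k)) x *\<^sub>R w x) \<in> borel_measurable lebesgue"
    unfolding set_integrable_def by auto
qed

section \<open>Assembly of the weak-type estimate\<close>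

theorem theorem2p3:
  assumes "CARD('n::finite) \<ge> 2"
  shows "\<exists>C>0. \<forall>(\<delta>::real) (w :: real^'n \<Rightarrow> real) (Q :: (real^'n) set) (l::real) (u :: real^'n \<Rightarrow> real).
    0 < \<delta> \<and> \<delta> < 1 \<and> A1_weight w \<and> cube_of_side l Q \<and> C1_on Q u \<longrightarrow>
      ennreal (l powr \<delta>) *
        weak_L1_norm Q w (\<lambda>x y. (u x - u y) / norm (x - y) powr (real CARD('n) + \<delta>))
      \<le> ennreal (C * (A1_const w powr (2 + (1 - \<delta>) / real CARD('n)) / (\<delta> * (1 - \<delta>))) * l) *
        (\<integral>\<^sup>+ x\<in>Q. ennreal (norm (grad_within Q u x) * w x) \<partial>lebesgue)"
proof -
  let ?n = "CARD('n)"
  \<comment> \<open>The factor \<open>4 * 2 ^ n\<close> comes from the dyadic sum,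
    \<open>3 ^ n\<close> from comparing balls with cubes, and \<open>n\<close> from the bound
    \<open>n * l\<close> for the diameter.\<close>
  define C :: real where "C = 4 * 6 ^ ?n * ?n"
  have "C > 0" by (simp add: C_def)
  moreover have "ennreal (l powr \<delta>) *
        weak_L1_norm Q w (\<lambda>x y. (u x - u y) / norm (x - y) powr (real CARD('n) + \<delta>))
      \<le> ennreal (C * (A1_const w powr (2 + (1 - \<delta>) / real CARD('n)) / (\<delta> * (1 - \<delta>))) * l) *
        (\<integral>\<^sup>+ x\<in>Q. ennreal (norm (grad_within Q u x) * w x) \<partial>lebesgue)"
    if d: "0 < \<delta>" "\<delta> < 1" and w: "A1_weight w" and Q: "cube_of_side l Q" and u: "C1_on Q u"
    for \<delta> l :: real and w :: "real^'n \<Rightarrow> real" and Q u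
  proof -
    let ?A = "A1_const w"
    let ?F = "\<lambda>x y. (u x - u y) / norm (x - y) powr (real ?n + \<delta>)"
    have A: "?A \<ge> 1" by (rule A1_const_ge_1[OF w])
    have l: "l > 0" using Q by (simp add: cube_of_side_def)
    define R where "R = ?n * l"
    have R: "R > 0" using l by (simp add: R_def)
    have [measurable]: "Q \<in> sets borel" by (rule cube_borel[OF Q])
    have wQ: "weight w" using w by (simp add: A1_weight_def)
    \<comment> \<open>The weight is only Lebesgue measurable. A Borel representative makes Tonelli's
      theorem and the substitutions on \<open>lborel\<close> available.\<close>
    obtain w' where w'[measurable]: "w' \<in> borel_measurable lborel" and w'eq: "AE x in lborel. w x = w' x"
      using completion_ex_borel_measurable_real[OF weight_borel_measurable[OF wQ]] by blast
    define W where "W = (\<lambda>x. ennreal (w' x))"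
    have [measurable]: "W \<in> borel_measurable borel" unfolding W_def using w' by simp
    have WAE: "AE x in lborel. ennreal (w x) = W x"
      using w'eq by eventually_elim (simp add: W_def)
    define g where "g = (\<lambda>z. ennreal (norm (grad_within Q u z)) * indicator Q z)"
    have "(\<lambda>z. indicator Q z *\<^sub>R norm (grad_within Q u z)) \<in> borel_measurable borel"
      using u by (intro borel_measurable_continuous_on_indicator continuous_intros) (auto simp: C1_on_def)
    note measurable_compose[OF this measurable_ennreal]
    moreover have "g = (\<lambda>z. ennreal (indicator Q z *\<^sub>R norm (grad_within Q u z)))"
      by (auto simp: g_def split: split_indicator)
    ultimately have [measurable]: "g \<in> borel_measurable borel"
      by (simp only: measurable_lborel1)
    define k where "k = (\<lambda>h::real^'n. ennreal (norm h powr (1 - real ?n - \<delta>)) * indicator (cball 0 R) h)"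
    have [measurable]: "k \<in> borel_measurable borel" unfolding k_def
      by (intro borel_measurable_times_ennreal borel_measurable_indicator) auto
    define B where "B = ennreal (4 * 2 ^ ?n * (?A * 3 ^ ?n) * R powr (1 - \<delta>) / (1 - \<delta>))"
    have avg: "AE z in lborel. (\<integral>\<^sup>+k. W k * indicator (cball z r) k \<partial>lborel) \<le> ennreal (?A * 3 ^ ?n * r ^ ?n) * W z"
      if "r > 0" for r
    proof -
      have "(\<integral>\<^sup>+k. ennreal (w k) * indicator (cball z r) k \<partial>lebesgue) = (\<integral>\<^sup>+k. W k * indicator (cball z r) k \<partial>lborel)" for z
        unfolding nn_integral_completion
        using WAE by (intro nn_integral_cong_AE) (auto elim!: eventually_mono)
      then show ?thesis
        using A1_ball_average[OF w that] WAE unfolding AE_completion_iff by (auto elim!: eventually_elim2)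
    qed
    have "AE z in lborel. (\<integral>\<^sup>+h. k h * W (z - s *\<^sub>R h) \<partial>lborel) \<le> B * W z" if "s > 0" for s
      unfolding k_def B_def
      using riesz_kernel_bound[of W "?A * 3 ^ ?n" R s \<delta>] avg A R d that by simp
    then have main: "(\<integral>\<^sup>+y. \<integral>\<^sup>+x. k (y - x) * W x * (\<integral>\<^sup>+s. g (x + s *\<^sub>R (y - x)) * indicator {0..1} s \<partial>lborel) \<partial>lborel \<partial>lborel)
      \<le> B * (\<integral>\<^sup>+z. g z * W z \<partial>lborel)"
      by (intro kernel_segment_integral_bound) auto
    \<comment> \<open>The segment integral supplies one factor \<open>norm (y - x)\<close>, which
      turns the exponent \<open>- n - \<delta>\<close> into \<open>1 - n - \<delta>\<close>. The
      cutoff in \<open>k\<close> has no effect here, because points of \<open>Q\<close> are at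
      distance at most \<open>R\<close>.\<close>
    have ptw: "ennreal \<bar>?F x y\<bar> \<le> k (y - x) * (\<integral>\<^sup>+s. g (x + s *\<^sub>R (y - x)) * indicator {0..1} s \<partial>lborel)" (is "_ \<le> _ * ?I")
      if xy: "x \<in> Q" "y \<in> Q" for x y
    proof (cases "x = y")
      case False
      let ?r = "norm (y - x)"
      have r: "?r > 0" using False by simp
      have "k (y - x) = ennreal (?r powr (1 - real ?n - \<delta>))"
        using cube_norm_diff_le[OF Q xy(2,1)] by (simp add: k_def R_def)
      also have "?r powr (1 - real ?n - \<delta>) = 1 / ?r powr (real ?n + \<delta>) * ?r"
        using r by (simp add: powr_diff powr_add field_simps)
      finally have k: "k (y - x) = ennreal (1 / ?r powr (real ?n + \<delta>)) * ennreal ?r"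
        by (subst ennreal_mult[symmetric]) auto
      have "ennreal \<bar>?F x y\<bar> = ennreal (1 / ?r powr (real ?n + \<delta>)) * ennreal \<bar>u x - u y\<bar>"
        by (subst ennreal_mult[symmetric]) (auto simp: abs_mult norm_minus_commute)
      also have "\<dots> \<le> ennreal (1 / ?r powr (real ?n + \<delta>)) * (ennreal ?r * ?I)"
        unfolding g_def using diff_le_segment_integral[OF cube_convex[OF Q] u xy] by (intro mult_left_mono) auto
      finally show ?thesis unfolding k by (simp add: mult.assoc)
    qed simp
    have "weak_L1_norm Q w ?F \<le> B * (\<integral>\<^sup>+z. g z * W z \<partial>lborel)"
      unfolding weak_L1_norm_def nn_integral_completion
    proof (rule SUP_least)
      fix t :: real assume "t \<in> {0<..}"
      then have t: "t > 0" by simp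
      let ?E = "\<lambda>x y. indicator {(x, y). \<bar>?F x y\<bar> > t} (x, y) * ennreal (w x)"
      let ?K = "\<lambda>x y. k (y - x) * W x * (\<integral>\<^sup>+s. g (x + s *\<^sub>R (y - x)) * indicator {0..1} s \<partial>lborel)"
      \<comment> \<open>Chebyshev's inequality in the inner integral: where the quotient exceeds
        \<open>t\<close> in absolute value, 1 is at most that absolute value divided by
        \<open>t\<close>.\<close>
      have le: "(\<integral>\<^sup>+x\<in>Q. ?E x y \<partial>lborel) \<le> (\<integral>\<^sup>+x. ennreal (1 / t) * ?K x y \<partial>lborel)" if y: "y \<in> Q" for y
      proof (rule nn_integral_mono_AE, use WAE in eventually_elim)
        case (elim x)
        show ?case
        proof (cases "x \<in> Q \<and> \<bar>?F x y\<bar> > t")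
          case True
          have "1 \<le> 1 / t * a" if "t < a" for a :: real using t that by (simp add: field_simps)
          then have "ennreal 1 \<le> ennreal (1 / t * \<bar>?F x y\<bar>)" using True by (blast intro: ennreal_leI)
          then have "1 \<le> ennreal (1 / t * \<bar>?F x y\<bar>)" by (simp only: ennreal_1)
          also have "\<dots> = ennreal (1 / t) * ennreal \<bar>?F x y\<bar>" using t by (intro ennreal_mult) auto
          also have "\<dots> \<le> ennreal (1 / t) * (k (y - x) * (\<integral>\<^sup>+s. g (x + s *\<^sub>R (y - x)) * indicator {0..1} s \<partial>lborel))"
            using True y by (intro mult_left_mono ptw) auto
          finally have "1 * W x \<le> \<dots> * W x" by (rule mult_right_mono) simp
          then show ?thesis using True elim by (simp add: ac_simps)
        qed auto
      qed
      have "(\<integral>\<^sup>+y\<in>Q. (\<integral>\<^sup>+x\<in>Q. ?E x y \<partial>lborel) \<partial>lborel) \<le> (\<integral>\<^sup>+y. \<integral>\<^sup>+x. ennreal (1 / t) * ?K x y \<partial>lborel \<partial>lborel)"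
        using le by (intro nn_integral_mono) (auto split: split_indicator)
      also have "\<dots> = (\<integral>\<^sup>+y. ennreal (1 / t) * (\<integral>\<^sup>+x. ?K x y \<partial>lborel) \<partial>lborel)"
        by (rule nn_integral_cong, rule nn_integral_cmult) measurable
      also have "\<dots> = ennreal (1 / t) * (\<integral>\<^sup>+y. \<integral>\<^sup>+x. ?K x y \<partial>lborel \<partial>lborel)"
        by (rule nn_integral_cmult) measurable
      also have "\<dots> \<le> ennreal (1 / t) * (B * (\<integral>\<^sup>+z. g z * W z \<partial>lborel))"
        by (intro mult_left_mono main) simp
      finally have "ennreal t * (\<integral>\<^sup>+y\<in>Q. (\<integral>\<^sup>+x\<in>Q. ?E x y \<partial>lborel) \<partial>lborel)
          \<le> ennreal t * (ennreal (1 / t) * (B * (\<integral>\<^sup>+z. g z * W z \<partial>lborel)))"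
        by (rule mult_left_mono) simp
      also have "\<dots> = B * (\<integral>\<^sup>+z. g z * W z \<partial>lborel)"
        using t by (subst mult.assoc[symmetric], subst ennreal_mult[symmetric]) auto
      finally show "ennreal t * (\<integral>\<^sup>+y\<in>Q. (\<integral>\<^sup>+x\<in>Q. ?E x y \<partial>lborel) \<partial>lborel) \<le> B * (\<integral>\<^sup>+z. g z * W z \<partial>lborel)" .
    qed
    then have "ennreal (l powr \<delta>) * weak_L1_norm Q w ?F \<le> ennreal (l powr \<delta>) * (B * (\<integral>\<^sup>+z. g z * W z \<partial>lborel))"
      by (rule mult_left_mono) simp
    also have "\<dots> = ennreal (l powr \<delta>) * B * (\<integral>\<^sup>+z. g z * W z \<partial>lborel)" by (simp add: mult.assoc)
    also have "(\<integral>\<^sup>+z. g z * W z \<partial>lborel) = (\<integral>\<^sup>+ x\<in>Q. ennreal (norm (grad_within Q u x) * w x) \<partial>lebesgue)"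
      unfolding nn_integral_completion
      using WAE by (intro nn_integral_cong_AE) (auto elim!: eventually_mono simp: g_def ennreal_mult' split: split_indicator)
    also have "ennreal (l powr \<delta>) * B \<le> ennreal (C * (?A powr (2 + (1 - \<delta>) / real ?n) / (\<delta> * (1 - \<delta>))) * l)"
    proof -
      have n1: "real ?n \<ge> 1" using assms by linarith
      \<comment> \<open>The powers of \<open>l\<close> recombine to \<open>l\<close> itself, and
        \<open>n powr (1 - \<delta>) \<le> n\<close> keeps the constant independent of
        \<delta>.\<close>
      have "R powr (1 - \<delta>) = real ?n powr (1 - \<delta>) * l powr (1 - \<delta>)"
        using l by (simp add: R_def powr_mult)
      also have "\<dots> \<le> real ?n * l powr (1 - \<delta>)"
        using powr_mono[of "1 - \<delta>" 1 "real ?n"] n1 d by (intro mult_right_mono) auto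
      finally have "l powr \<delta> * R powr (1 - \<delta>) \<le> l powr \<delta> * (real ?n * l powr (1 - \<delta>))"
        by (rule mult_left_mono) simp
      also have "\<dots> = real ?n * l" using l by (simp add: powr_diff)
      finally have lR: "l powr \<delta> * R powr (1 - \<delta>) \<le> real ?n * l" .
      \<comment> \<open>The kernel estimate carries the first power of \<open>?A\<close>; the
        exponent of the claim is reached by monotonicity for bases at least 1.\<close>
      have "?A powr 1 \<le> ?A powr (2 + (1 - \<delta>) / real ?n)"
        using A d by (intro powr_mono) (auto simp: add_nonneg_pos add_increasing2)
      then have Ap: "?A \<le> ?A powr (2 + (1 - \<delta>) / real ?n)" using A by simp
      have dd: "1 / (1 - \<delta>) \<le> 1 / (\<delta> * (1 - \<delta>))"
        using d by (intro divide_left_mono) auto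
      have "l powr \<delta> * (4 * 2 ^ ?n * (?A * 3 ^ ?n) * R powr (1 - \<delta>) / (1 - \<delta>))
        = 4 * 6 ^ ?n * (l powr \<delta> * R powr (1 - \<delta>)) * (?A * (1 / (1 - \<delta>)))"
        using power_mult_distrib[of "2::real" 3 ?n] by simp
      also have "\<dots> \<le> 4 * 6 ^ ?n * (real ?n * l) * (?A powr (2 + (1 - \<delta>) / real ?n) * (1 / (\<delta> * (1 - \<delta>))))"
        using A d l by (intro mult_mono[OF mult_left_mono[OF lR] mult_mono[OF Ap dd]]) auto
      also have "\<dots> = C * (?A powr (2 + (1 - \<delta>) / real ?n) / (\<delta> * (1 - \<delta>))) * l"
        by (simp add: C_def)
      finally show ?thesis unfolding B_def by (subst ennreal_mult'[symmetric]) (auto intro: ennreal_leI)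
    qed
    finally show ?thesis by (simp add: mult_right_mono)
  qed
  ultimately show ?thesis by blast
qed

end
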